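(* Let $\kappa$ be an initial ordinal. If the ordering of a poset $\mathbf p$ is the intersection of finitely many (at least one) WPO orderings on its vertex set, each of length $\kappa$, then $\mathbf p$ (which is a WPO) has length $\kappa$.
   Context: Orderings are partial orders, seen as sets of ordered pairs; the intersection of orderings on the same set is their set-theoretic intersection. A poset is well partially ordered (WPO) if it is well founded and has no infinite antichain; equivalently all its linear extensions are well orders. The length $\ell(\mathbf p)$ of a WPO $\mathbf p$ is the largest ordinal type of a linear extension of $\mathbf p$ (the maximum exists by de Jongh–Parikh). The length of an ordering is the length of the corresponding poset. An ordinal is initial if it is equal to its cardinality, i.e. it is not equipotent to any smaller ordinal. *)

theory Defs
  imports Main
begin

unbundle cardinal_syntax

definition antichain_on :: "'a set \<Rightarrow> 'a rel \<Rightarrow> 'a set \<Rightarrow> bool" where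
  "antichain_on A r X \<longleftrightarrow>
     X \<subseteq> A \<and> (\<forall>x\<in>X. \<forall>y\<in>X. x \<noteq> y \<longrightarrow> (x, y) \<notin> r \<and> (y, x) \<notin> r)"

definition wpo_on :: "'a set \<Rightarrow> 'a rel \<Rightarrow> bool" where
  "wpo_on A r \<longleftrightarrow>
     partial_order_on A r \<and> wf (r - Id) \<and> \<not> (\<exists>X. antichain_on A r X \<and> infinite X)"

definition linear_extension_on :: "'a set \<Rightarrow> 'a rel \<Rightarrow> 'a rel \<Rightarrow> bool" where
  "linear_extension_on A r L \<longleftrightarrow> linear_order_on A L \<and> r \<subseteq> L"

(* Ordinals are represented by well-ordered relations \<kappa>, on any type, up to =o.
   The length is a relation between an ordering and \<kappa>: \<kappa> is the largest order type of a
   linear extension, and that type is attained. It determines \<kappa> up to =o. *)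
definition has_length :: "'a set \<Rightarrow> 'a rel \<Rightarrow> 'b rel \<Rightarrow> bool" where
  "has_length A r \<kappa> \<longleftrightarrow>
     (\<exists>L. linear_extension_on A r L \<and> L =o \<kappa>) \<and>
     (\<forall>L. linear_extension_on A r L \<longrightarrow> L \<le>o \<kappa>)"

end

theory Submission
  imports Defs "HOL-Library.Ramsey"
begin

text \<open>
  Let \<open>L\<close> be a linear extension of \<open>p\<close> and \<open>x\<close> a vertex. Every \<open>y\<close> strictly \<open>L\<close>-below \<open>x\<close>
  satisfies \<open>(x, y) \<notin> p\<close>, hence \<open>(x, y) \<notin> q\<close> for one of the finitely many \<open>q \<in> Q\<close>. For fixed
  \<open>q\<close>, the elements not \<open>q\<close>-above \<open>x\<close> form a down-set, so some linear extension of \<open>q\<close> puts all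
  of them before \<open>x\<close>; its type is at most the initial ordinal \<open>\<kappa>\<close>, so there are fewer than
  \<open>\<kappa>\<close> of them. If \<open>\<kappa>\<close> is infinite, all proper initial segments of \<open>L\<close> therefore have fewer
  than \<open>\<kappa>\<close> elements, and \<open>L\<close> has type at most \<open>\<kappa>\<close>. The bound is attained because a linear
  extension of any \<open>q \<in> Q\<close> also extends \<open>p\<close>.
\<close>

text \<open>Ramsey's theorem for three colours of index pairs: a homogeneous set of either unwanted
  colour would yield an infinite descending chain or an infinite antichain. Starting from an
  arbitrary infinite \<open>Z\<close> allows one ordering after another to be treated.\<close>

lemma wpo_on_increasing_subsequence:
  fixes f :: "nat \<Rightarrow> 'a"
  assumes "wpo_on A r" and f: "\<And>i. f i \<in> A" and "infinite Z"
  shows "\<exists>Y\<subseteq>Z. infinite Y \<and> (\<forall>i\<in>Y. \<forall>j\<in>Y. i < j \<longrightarrow> (f i, f j) \<in> r)"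
proof -
  have refl: "\<And>a. a \<in> A \<Longrightarrow> (a, a) \<in> r" and wf: "wf (r - Id)"
    and no_antichain: "\<And>X. antichain_on A r X \<Longrightarrow> finite X"
    using assms(1) by (auto simp: wpo_on_def partial_order_on_def preorder_on_def refl_on_def)
  define c :: "nat \<Rightarrow> nat \<Rightarrow> nat" where
    "c i j = (if (f i, f j) \<in> r then 0 else if (f j, f i) \<in> r then 1 else 2)" for i j
  \<comment> \<open>\<open>Ramsey2\<close> colours unordered pairs, so \<open>Min\<close> and
    \<open>Max\<close> recover the order of the two indices.\<close>
  have "\<forall>i\<in>Z. \<forall>j\<in>Z. i \<noteq> j \<longrightarrow> (\<lambda>S. c (Min S) (Max S)) {i, j} < 3"
    by (simp add: c_def)
  from Ramsey2[OF \<open>infinite Z\<close> this] obtain Y t where Y: "Y \<subseteq> Z" "infinite Y" and "t < 3"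
    and t: "\<And>i j. i \<in> Y \<Longrightarrow> j \<in> Y \<Longrightarrow> i \<noteq> j \<Longrightarrow> c (Min {i, j}) (Max {i, j}) = t"
    by blast
  have c: "c i j = t" if "i \<in> Y" "j \<in> Y" "i < j" for i j
    using t[of i j] that by (simp add: min_def max_def)
  consider "t = 0" | "t = 1" | "t = 2" using \<open>t < 3\<close> by linarith
  then show ?thesis
  proof cases
    case 1
    then show ?thesis using c Y unfolding c_def by (metis one_neq_zero zero_neq_numeral)
  next
    case 2
    have "(f (enumerate Y (Suc n)), f (enumerate Y n)) \<in> r - Id" for n
    proof -
      have "c (enumerate Y n) (enumerate Y (Suc n)) = 1"
        using c[of "enumerate Y n" "enumerate Y (Suc n)"] 2 Y(2)
        by (simp add: enumerate_in_set enumerate_step)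
      then show ?thesis using refl f by (auto simp: c_def split: if_splits)
    qed
    then have "\<exists>g. \<forall>n. (g (Suc n), g n) \<in> r - Id"
      by (intro exI[of _ "\<lambda>n. f (enumerate Y n)"]) blast
    then show ?thesis using wf wf_iff_no_infinite_down_chain by metis
  next
    case 3
    have incomparable: "(f i, f j) \<notin> r \<and> (f j, f i) \<notin> r" if "i \<in> Y" "j \<in> Y" "i \<noteq> j" for i j
      using c[of i j] c[of j i] that 3 by (cases "i < j") (auto simp: c_def split: if_splits)
    \<comment> \<open>Equal values would be comparable by reflexivity; so the antichain really is
      infinite.\<close>
    then have "inj_on f Y" using refl f by (metis inj_onI)
    then have "infinite (f ` Y)" using Y(2) finite_imageD by blast
    moreover have "antichain_on A r (f ` Y)"
      using incomparable f unfolding antichain_on_def by blast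
    ultimately show ?thesis using no_antichain by blast
  qed
qed

lemma wpo_on_common_increasing_subsequence:
  fixes f :: "nat \<Rightarrow> 'a"
  assumes "finite Q" "\<And>q. q \<in> Q \<Longrightarrow> wpo_on A q" and f: "\<And>i. f i \<in> A"
  shows "\<exists>Y. infinite Y \<and> (\<forall>i\<in>Y. \<forall>j\<in>Y. i < j \<longrightarrow> (f i, f j) \<in> \<Inter> Q)"
  using assms(1,2)
proof (induction Q)
  case empty
  then show ?case by auto
next
  case (insert q Q)
  then obtain Y where Y: "infinite Y" "\<forall>i\<in>Y. \<forall>j\<in>Y. i < j \<longrightarrow> (f i, f j) \<in> \<Inter> Q" by auto
  obtain Y' where "Y' \<subseteq> Y" "infinite Y'" "\<forall>i\<in>Y'. \<forall>j\<in>Y'. i < j \<longrightarrow> (f i, f j) \<in> q"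
    using wpo_on_increasing_subsequence[of A q f Y] insert.prems f Y(1) by blast
  with Y show ?case by (intro exI[of _ Y']) auto
qed

text \<open>In a strictly \<open>s\<close>-descending sequence every later term lies below every
  earlier one, and the good pair supplied by \<open>r\<close> contradicts antisymmetry. A separate
  \<open>s\<close> covers both \<open>r\<close> itself and its linear extensions.\<close>

lemma wf_extension:
  assumes good: "\<And>f :: nat \<Rightarrow> 'a. (\<And>i. f i \<in> A) \<Longrightarrow> \<exists>i j. i < j \<and> (f i, f j) \<in> r"
    and "partial_order_on A s" "r \<subseteq> s"
  shows "wf (s - Id)"
  unfolding wf_iff_no_infinite_down_chain
proof
  assume "\<exists>f. \<forall>i. (f (Suc i), f i) \<in> s - Id"
  then obtain f where f: "\<And>i. (f (Suc i), f i) \<in> s - Id" by blast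
  have s: "trans s" "antisym s" "s \<subseteq> A \<times> A"
    using partial_order_onD[OF assms(2)] by auto
  then have tr: "trans (s - Id)" by (simp add: trans_diff_Id)
  have "(f j, f i) \<in> s - Id" if "i < j" for i j
    using that
  proof (induction rule: strict_inc_induct)
    case (base i)
    then show ?case using f by simp
  next
    case (step i)
    then show ?case using f[of i] tr by (meson transD)
  qed
  moreover have "\<And>i. f i \<in> A" using f s(3) by blast
  then obtain i j where "i < j" "(f i, f j) \<in> s" using good \<open>r \<subseteq> s\<close> by blast
  ultimately show False using s(2) by (metis DiffE antisymD pair_in_Id_conv)
qed

text \<open>A subsequence increasing for all of \<open>Q\<close> at once gives every sequence in
  \<open>A\<close> a good pair for the intersection. This rules out infinite antichains, and
  descending chains in every partial order extending it.\<close>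

lemma wpo_on_Inter:
  assumes "partial_order_on A (\<Inter> Q)" "finite Q" "\<And>q. q \<in> Q \<Longrightarrow> wpo_on A q"
  shows "wpo_on A (\<Inter> Q)"
    and "linear_extension_on A (\<Inter> Q) L \<Longrightarrow> well_order_on A L"
proof -
  have good: "\<exists>i j. i < j \<and> (f i, f j) \<in> \<Inter> Q" if f: "\<And>i. f i \<in> A" for f :: "nat \<Rightarrow> 'a"
  proof -
    obtain Y where Y: "infinite Y" "\<forall>i\<in>Y. \<forall>j\<in>Y. i < j \<longrightarrow> (f i, f j) \<in> \<Inter> Q"
      using wpo_on_common_increasing_subsequence[of Q A f, OF assms(2,3) f] by metis
    obtain i where "i \<in> Y" using Y(1) by fastforce
    moreover obtain j where "j \<in> Y" "i < j" using Y(1) by (meson infinite_nat_iff_unbounded)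
    ultimately show ?thesis using Y(2) by blast
  qed
  have "finite X" if X: "antichain_on A (\<Inter> Q) X" for X
  proof (rule ccontr)
    assume "infinite X"
    then obtain f :: "nat \<Rightarrow> 'a" where f: "inj f" "range f \<subseteq> X"
      using infinite_countable_subset by blast
    with X have "\<And>i. f i \<in> A" unfolding antichain_on_def by blast
    from good[of f, OF this] obtain i j where "i < j" "(f i, f j) \<in> \<Inter> Q" by metis
    moreover have "f i \<noteq> f j" using f(1) \<open>i < j\<close> by (simp add: inj_eq)
    ultimately show False using X f(2) unfolding antichain_on_def by blast
  qed
  moreover have "wf (\<Inter> Q - Id)"
    by (rule wf_extension[OF good assms(1) order_refl])
  ultimately show "wpo_on A (\<Inter> Q)"
    using assms(1) unfolding wpo_on_def by blast
  show "well_order_on A L" if "linear_extension_on A (\<Inter> Q) L"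
  proof -
    have L: "linear_order_on A L" "\<Inter> Q \<subseteq> L"
      using that by (auto simp: linear_extension_on_def)
    then have "wf (L - Id)"
      by (intro wf_extension[OF good]) (auto simp: linear_order_on_def)
    with L(1) show ?thesis by (simp add: well_order_on_def)
  qed
qed

text \<open>Moving the block \<open>D\<close> to the front keeps \<open>L\<close> inside each block,
  and no pair of \<open>q\<close> leads from outside \<open>D\<close> into \<open>D\<close>.\<close>

lemma linear_extension_on_downset_first:
  assumes "linear_extension_on A q L" "D \<subseteq> A" "\<And>a b. (a, b) \<in> q \<Longrightarrow> b \<in> D \<Longrightarrow> a \<in> D"
  shows "linear_extension_on A q ({(a, b) \<in> L. a \<in> D \<longleftrightarrow> b \<in> D} \<union> D \<times> (A - D))"
proof -
  have L: "L \<subseteq> A \<times> A" "refl_on A L" "trans L" "antisym L" "total_on A L" "q \<subseteq> L"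
    using assms(1)
    by (auto simp: linear_extension_on_def linear_order_on_def partial_order_on_def preorder_on_def)
  let ?L = "{(a, b) \<in> L. a \<in> D \<longleftrightarrow> b \<in> D} \<union> D \<times> (A - D)"
  have "?L \<subseteq> A \<times> A" using L(1) assms(2) by auto
  moreover have "refl_on A ?L" using L(2) by (auto simp: refl_on_def)
  moreover have "trans ?L" using L(1) by (auto intro!: transI dest: transD[OF L(3)])
  moreover have "antisym ?L" by (auto intro!: antisymI dest: antisymD[OF L(4)])
  moreover have "total_on A ?L" using L(5) by (auto simp: total_on_def)
  moreover have "q \<subseteq> ?L" using L(1,6) assms(3) by auto
  ultimately show ?thesis
    by (simp add: linear_extension_on_def linear_order_on_def partial_order_on_def preorder_on_def)
qed

lemma card_of_not_above:
  fixes \<kappa> :: "'b rel"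
  assumes \<kappa>: "Card_order \<kappa>" and "partial_order_on A q" "has_length A q \<kappa>" "x \<in> A"
  shows "|{y \<in> A. (x, y) \<notin> q}| <o \<kappa>"
proof -
  let ?D = "{y \<in> A. (x, y) \<notin> q}"
  have q: "refl_on A q" "trans q" "q \<subseteq> A \<times> A"
    using partial_order_onD[OF assms(2)] by auto
  obtain L where "linear_extension_on A q L"
    using assms(3) unfolding has_length_def by blast
  then have ext: "linear_extension_on A q ({(a, b) \<in> L. a \<in> ?D \<longleftrightarrow> b \<in> ?D} \<union> ?D \<times> (A - ?D))"
    using q by (intro linear_extension_on_downset_first) (auto dest: transD)
  define L' where "L' = {(a, b) \<in> L. a \<in> ?D \<longleftrightarrow> b \<in> ?D} \<union> ?D \<times> (A - ?D)"
  have "x \<in> A - ?D" using assms(4) q(1) by (auto simp: refl_on_def)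
  \<comment> \<open>As \<open>x\<close> is outside \<open>?D\<close>, the whole block precedes it;
    an embedding into \<kappa> then sends the segment below \<open>x\<close> onto a proper initial
    segment of a cardinal.\<close>
  then have sub: "?D \<subseteq> underS L' x" unfolding underS_def L'_def by blast
  have "L' \<le>o \<kappa>" using ext assms(3) unfolding has_length_def L'_def by blast
  then obtain f where L': "Well_order L'" and f: "embed L' \<kappa> f" unfolding ordLeq_def by blast
  have "x \<in> Field L'"
    using ext assms(4) unfolding L'_def linear_extension_on_def linear_order_on_def
      partial_order_on_def preorder_on_def refl_on_def Field_def by blast
  then have "|underS L' x| =o |underS \<kappa> (f x)|" and "f x \<in> Field \<kappa>"
    using embed_underS[OF L' f] embed_Field[OF f] card_of_ordIso by blast+
  then have "|underS L' x| <o \<kappa>"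
    using card_of_underS[OF \<kappa>] ordIso_ordLess_trans by blast
  then show ?thesis using card_of_mono1[OF sub] ordLeq_ordLess_trans by blast
qed

lemma card_of_finite_UNION_ordLess:
  assumes "finite I" "Card_order r" "infinite (Field r)" "\<And>i. i \<in> I \<Longrightarrow> |B i| <o r"
  shows "|\<Union>i\<in>I. B i| <o r"
  using assms(1,4)
proof (induction I)
  case empty
  have "Field r \<noteq> {}" using assms(3) by auto
  then have "|{}| <o |Field r|" using card_of_ordLess2[of "Field r" "{}"] by simp
  then show ?case using card_of_Field_ordIso[OF assms(2)] ordLess_ordIso_trans by simp
next
  case (insert i I)
  then have "|B i| <o r" "|\<Union>i\<in>I. B i| <o r" by auto
  from card_of_Un_ordLess_infinite_Field[OF assms(3,2) this] show ?case by simp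
qed

text \<open>If \<open>L\<close> were longer, \<kappa> would be isomorphic to a proper initial
  segment of \<open>L\<close>, which has too few elements.\<close>

lemma well_order_on_ordLeq_Card_order:
  assumes \<kappa>: "Card_order \<kappa>" and L: "well_order_on A L"
    and small: "\<And>x. x \<in> A \<Longrightarrow> |underS L x| <o \<kappa>"
  shows "L \<le>o \<kappa>"
proof -
  have A: "Well_order L" "Field L = A" using L well_order_on_Well_order by blast+
  have \<kappa>': "Well_order \<kappa>" using \<kappa> by (simp add: card_order_on_def)
  have "\<not> \<kappa> <o L"
  proof
    assume "\<kappa> <o L"
    then obtain x where x: "x \<in> A" and iso: "\<kappa> =o Restr L (underS L x)"
      using ordLess_iff_ordIso_Restr[OF A(1) \<kappa>'] A(2) by blast
    have "|Field \<kappa>| =o |Field (Restr L (underS L x))|" using card_of_cong[OF iso] .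
    moreover have "|Field (Restr L (underS L x))| \<le>o |underS L x|"
      by (rule card_of_mono1) (auto simp: Field_def)
    ultimately have "|Field \<kappa>| <o \<kappa>"
      using small[OF x] ordIso_ordLeq_trans ordLeq_ordLess_trans by blast
    then show False using card_of_Field_ordIso[OF \<kappa>] not_ordLess_ordIso by blast
  qed
  then show ?thesis using not_ordLeq_iff_ordLess[OF \<kappa>' A(1)] by blast
qed

theorem corollary1p1:
  fixes \<kappa> :: "'b rel" and A :: "'a set" and p :: "'a rel" and Q :: "'a rel set"
  assumes "Card_order \<kappa>"
    and "partial_order_on A p"
    and "finite Q" and "Q \<noteq> {}"
    and "\<And>q. q \<in> Q \<Longrightarrow> wpo_on A q \<and> has_length A q \<kappa>"
    and "p = \<Inter> Q"
  shows "wpo_on A p \<and> has_length A p \<kappa>"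
proof -
  have wpo: "wpo_on A p" and wo: "\<And>L. linear_extension_on A p L \<Longrightarrow> well_order_on A L"
    using wpo_on_Inter[of A Q] assms by auto
  obtain q L0 where "q \<in> Q" "linear_extension_on A q L0" and L0: "L0 =o \<kappa>"
    using assms(4,5) unfolding has_length_def by blast
  then have L0_ext: "linear_extension_on A p L0"
    using assms(6) unfolding linear_extension_on_def by blast
  have "L \<le>o \<kappa>" if L: "linear_extension_on A p L" for L
  proof (cases "finite A")
    case True
    then have "L =o L0" using finite_well_order_on_ordIso wo L L0_ext by blast
    then show ?thesis using L0 ordIso_transitive ordIso_iff_ordLeq by blast
  next
    case False
    have "Field L0 = A" using wo[OF L0_ext] well_order_on_Well_order by blast
    then have inf: "infinite (Field \<kappa>)"
      using False card_of_cong[OF L0] card_of_ordIso_finite by blast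
    have "|underS L x| <o \<kappa>" if x: "x \<in> A" for x
    proof -
      have "L \<subseteq> A \<times> A" "antisym L" "p \<subseteq> L"
        using L unfolding linear_extension_on_def linear_order_on_def partial_order_on_def
          preorder_on_def by auto
      then have "\<And>y. y \<in> underS L x \<Longrightarrow> y \<in> A \<and> (x, y) \<notin> p"
        unfolding underS_def antisym_def by blast
      then have "underS L x \<subseteq> (\<Union>q\<in>Q. {y \<in> A. (x, y) \<notin> q})"
        unfolding assms(6) by blast
      moreover have "|\<Union>q\<in>Q. {y \<in> A. (x, y) \<notin> q}| <o \<kappa>"
        using card_of_not_above[OF assms(1) _ _ x] assms(5)
        by (intro card_of_finite_UNION_ordLess assms(1,3) inf) (auto simp: wpo_on_def)
      ultimately show ?thesis using card_of_mono1 ordLeq_ordLess_trans by blast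
    qed
    then show ?thesis using well_order_on_ordLeq_Card_order assms(1) wo[OF L] by blast
  qed
  then show ?thesis using wpo L0_ext L0 unfolding has_length_def by blast
qed

end
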